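(* For $k=1,2,\dots,l$, let $\{T_{k,i}\}_{i\in I}\subseteq X_F^{*}$ be a $p$-frame associated to $(a_2,\dots,a_n)$ for $X$, and let $\{\alpha_k\}_{k=1}^{l}$ be any scalars. Then $\big\{\sum_{k=1}^{l}\alpha_kT_{k,i}\big\}_{i\in I}$ is a $p$-frame associated to $(a_2,\dots,a_n)$ for $X$ if there exist $\beta>0$ and some $m\in\{1,2,\dots,l\}$ such that, for all $x\in X$, $$\beta\sum_{i\in I}|T_{m,i}(x,a_2,\dots,a_n)|^p\le\sum_{i\in I}\Big|\sum_{k=1}^{l}\alpha_kT_{k,i}(x,a_2,\dots,a_n)\Big|^p.$$
   Context: Let $\mathbb K\in\{\mathbb R,\mathbb C\}$, $n\ge 2$, $p\in(1,\infty)$, and let $I$ be a countable index set. An $n$-norm on a linear space $X$ over $\mathbb K$ is a map $\|\cdot,\dots,\cdot\|_X:X^n\to\mathbb R$ such that (i) $\|x_1,\dots,x_n\|_X=0$ iff $x_1,\dots,x_n$ are linearly dependent; (ii) it is invariant under permutations of its arguments; (iii) $\|\alpha x_1,x_2,\dots,x_n\|_X=|\alpha|\,\|x_1,\dots,x_n\|_X$ for $\alpha\in\mathbb K$; (iv) $\|x+y,x_2,\dots,x_n\|_X\le\|x,x_2,\dots,x_n\|_X+\|y,x_2,\dots,x_n\|_X$. A sequence $\{x_k\}$ converges to $x$ if $\|x_k-x,x_2,\dots,x_n\|_X\to0$ for all $x_2,\dots,x_n\in X$, and is Cauchy if $\|x_l-x_k,x_2,\dots,x_n\|_X\to0$ as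 $l,k\to\infty$ for all $x_2,\dots,x_n\in X$; $X$ is an $n$-Banach space if every Cauchy sequence converges. $X$ is an $n$-Banach space and $a_2,\dots,a_n\in X$ are fixed. A bounded $b$-linear functional on $X\times\langle a_2\rangle\times\cdots\times\langle a_n\rangle$ ($\langle a_i\rangle$ is the subspace generated by $a_i$) is a map $T$ from this set to $\mathbb K$ with $T(x+y,a_2,\dots,a_n)=T(x,a_2,\dots,a_n)+T(y,a_2,\dots,a_n)$, $T(kx,a_2,\dots,a_n)=kT(x,a_2,\dots,a_n)$ for $x,y\in X$, $k\in\mathbb K$, and for which there is $M>0$ with $|T(x,a_2,\dots,a_n)|\le M\|x,a_2,\dots,a_n\|_X$ for all $x\in X$. $X_F^{*}$ is the space of all of these. A countable family $\{T_i\}_{i\in I}\subseteq X_F^{*}$ is a $p$-frame associated to $(a_2,\dots,a_n)$ for $X$ if there are constants $A,B>0$ with $A\|x,a_2,\dots,a_n\|_X^p\le\sum_{i\in I}|T_i(x,a_2,\dots,a_n)|^p\le B\|x,a_2,\dots,a_n\|_X^p$ for all $x\in X$. *)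

theory Defs
  imports "HOL-Analysis.Analysis" "HOL-Library.Multiset"
begin

text \<open>
  Tuples $(x_1,\dots,x_n)$ are lists of length $n$. The scalar field is an arbitrary
  \<open>real_normed_field\<close>: its norm is multiplicative, so by Ostrowski's theorem (or Gelfand--Mazur)
  it is isometrically isomorphic to the reals or to the complex numbers, and both are instances.
\<close>

context vector_space
begin

text \<open>
  Linear dependence of a tuple rather than of a set of vectors: a tuple with a repeated
  entry is dependent.
\<close>

definition dependent_tuple :: "'b list \<Rightarrow> bool" where
  "dependent_tuple xs \<longleftrightarrow>
     (\<exists>c. (\<exists>i<length xs. c i \<noteq> 0) \<and> (\<Sum>i<length xs. scale (c i) (xs ! i)) = 0)"

text \<open>The set $X \times \langle a_2\rangle \times\dots\times \langle a_n\rangle$, for \<open>a\<close> the list $a_2,\dots,a_n$.\<close>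

definition b_domain :: "'b list \<Rightarrow> 'b list set" where
  "b_domain a = {x # ys | x ys. list_all2 (\<lambda>y b. y \<in> span {b}) ys a}"

end

locale n_normed_space = vector_space scale
  for scale :: "'k::real_normed_field \<Rightarrow> 'x::ab_group_add \<Rightarrow> 'x" +
  fixes n :: nat and nnorm :: "'x list \<Rightarrow> real"
  assumes n_ge_2: "n \<ge> 2"
    and nnorm_eq_0_iff: "length xs = n \<Longrightarrow> nnorm xs = 0 \<longleftrightarrow> dependent_tuple xs"
    and nnorm_perm: "length xs = n \<Longrightarrow> mset ys = mset xs \<Longrightarrow> nnorm ys = nnorm xs"
    and nnorm_scale: "length xs = n - 1 \<Longrightarrow> nnorm (scale c x # xs) = norm c * nnorm (x # xs)"
    and nnorm_triangle:
      "length xs = n - 1 \<Longrightarrow> nnorm ((x + y) # xs) \<le> nnorm (x # xs) + nnorm (y # xs)"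
begin

definition n_converges :: "(nat \<Rightarrow> 'x) \<Rightarrow> 'x \<Rightarrow> bool" where
  "n_converges s x \<longleftrightarrow>
     (\<forall>ys. length ys = n - 1 \<longrightarrow> (\<lambda>k. nnorm ((s k - x) # ys)) \<longlonglongrightarrow> 0)"

definition n_Cauchy :: "(nat \<Rightarrow> 'x) \<Rightarrow> bool" where
  "n_Cauchy s \<longleftrightarrow>
     (\<forall>ys. length ys = n - 1 \<longrightarrow>
        ((\<lambda>(l, k). nnorm ((s l - s k) # ys)) \<longlongrightarrow> 0) (sequentially \<times>\<^sub>F sequentially))"

text \<open>
  The space $X_F^*$. Functionals live on \<open>b_domain a\<close> only, which is encoded by
  extensionality: they are \<open>undefined\<close> outside of it.
\<close>

definition b_dual :: "'x list \<Rightarrow> ('x list \<Rightarrow> 'k) set" where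
  "b_dual a = {T \<in> b_domain a \<rightarrow>\<^sub>E UNIV.
     (\<forall>x y. T ((x + y) # a) = T (x # a) + T (y # a)) \<and>
     (\<forall>c x. T (scale c x # a) = c * T (x # a)) \<and>
     (\<exists>M>0. \<forall>x. norm (T (x # a)) \<le> M * nnorm (x # a))}"

text \<open>
  The sum is taken in \<open>[0, \<infinity>]\<close>, where it always exists, so that the upper bound includes
  the convergence of the series.
\<close>

definition p_frame :: "real \<Rightarrow> 'x list \<Rightarrow> 'i set \<Rightarrow> ('i \<Rightarrow> 'x list \<Rightarrow> 'k) \<Rightarrow> bool" where
  "p_frame p a I T \<longleftrightarrow> countable I \<and> (\<forall>i\<in>I. T i \<in> b_dual a) \<and>
     (\<exists>A>0. \<exists>B>0. \<forall>x.
        ennreal (A * nnorm (x # a) powr p) \<le> (\<Sum>\<^sub>\<infinity>i\<in>I. ennreal (norm (T i (x # a)) powr p)) \<and>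
        (\<Sum>\<^sub>\<infinity>i\<in>I. ennreal (norm (T i (x # a)) powr p)) \<le> ennreal (B * nnorm (x # a) powr p))"

end

locale n_Banach_space = n_normed_space +
  assumes n_complete: "n_Cauchy s \<Longrightarrow> \<exists>x. n_converges s x"

end

theory Submission
  imports Defs
begin

text \<open>
  Write \<open>S\<^sub>i = (\<Sum>k. \<alpha>\<^sub>k T\<^sub>k\<^sub>,\<^sub>i)\<close>. The \<open>S\<^sub>i\<close> are bounded \<open>b\<close>-linear because
  \<open>b_dual\<close> is closed under finite linear combinations (\<open>b_dual_linear_combination\<close>). The upper
  frame inequality holds unconditionally: from the elementary inequality
  \<open>(\<Sum>k\<in>K. s\<^sub>k)\<^sup>p \<le> card K\<^sup>p (\<Sum>k\<in>K. s\<^sub>k\<^sup>p)\<close> one gets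
  \<open>(\<Sum>i. |S\<^sub>i x|\<^sup>p) \<le> (\<Sum>k. card K\<^sup>p |\<alpha>\<^sub>k|\<^sup>p (\<Sum>i. |T\<^sub>k\<^sub>,\<^sub>i x|\<^sup>p))\<close>, and each inner sum is
  controlled by the upper frame bound of its own family
  (\<open>linear_combination_upper_bound\<close>). The lower inequality is where the comparison hypothesis
  enters: if \<open>A\<close> is a lower frame bound of the family number \<open>m\<close>, then \<open>\<beta> A\<close> is one of \<open>S\<close>.

  Minkowski's inequality would give a sharper upper bound, but no particular constant is needed.
\<close>

lemma sum_powr_le:
  fixes s :: "'a \<Rightarrow> real"
  assumes K: "finite K" and s: "\<And>k. k \<in> K \<Longrightarrow> 0 \<le> s k" and p: "0 \<le> p"
  shows "(\<Sum>k\<in>K. s k) powr p \<le> real (card K) powr p * (\<Sum>k\<in>K. s k powr p)"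
proof (cases "K = {}")
  case False
  define M where "M = Max (s ` K)"
  have M: "s k \<le> M" if "k \<in> K" for k
    using K that by (simp add: M_def)
  have "M \<in> s ` K"
    unfolding M_def using K False by (intro Max_in) auto
  then obtain j where j: "j \<in> K" "M = s j"
    by auto
  have "(\<Sum>k\<in>K. s k) powr p \<le> (real (card K) * M) powr p"
    using sum_bounded_above[OF M] p s by (intro powr_mono2 sum_nonneg) auto
  also have "\<dots> = real (card K) powr p * s j powr p"
    using s j by (simp add: powr_mult)
  also have "s j powr p \<le> (\<Sum>k\<in>K. s k powr p)"
    using K j by (intro member_le_sum) auto
  finally show ?thesis
    by (simp add: mult_left_mono)
qed simp

lemma infsum_ennreal_le:
  fixes f :: "'a \<Rightarrow> ennreal"
  assumes "\<And>F. finite F \<Longrightarrow> F \<subseteq> I \<Longrightarrow> sum f F \<le> c"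
  shows "infsum f I \<le> c"
  using assms by (auto simp: nonneg_infsum_complete intro!: SUP_least)

lemma sum_le_infsum_ennreal:
  fixes f :: "'a \<Rightarrow> ennreal"
  assumes "finite F" "F \<subseteq> I"
  shows "sum f F \<le> infsum f I"
  using assms by (auto simp: nonneg_infsum_complete intro!: SUP_upper)

context vector_space
begin

lemma Cons_in_b_domain: "x # a \<in> b_domain a"
  by (auto simp: b_domain_def list_all2_conv_all_nth span_base)

end

context n_normed_space
begin

lemma nnorm_nonneg:
  assumes "length ys = n - 1"
  shows "0 \<le> nnorm (x # ys)"
proof -
  have "0 = nnorm (scale 0 x # ys)"
    by (subst nnorm_scale[OF assms]) simp
  also have "\<dots> = nnorm ((x + scale (- 1) x) # ys)"
    by simp
  also have "\<dots> \<le> nnorm (x # ys) + nnorm (scale (- 1) x # ys)"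
    by (rule nnorm_triangle[OF assms])
  also have "\<dots> = 2 * nnorm (x # ys)"
    by (subst nnorm_scale[OF assms]) simp
  finally show ?thesis
    by simp
qed

lemma b_dual_linear_combination:
  assumes a: "length a = n - 1" and T: "\<And>k. k \<in> K \<Longrightarrow> T k \<in> b_dual a"
  shows "(\<lambda>u\<in>b_domain a. \<Sum>k\<in>K. \<alpha> k * T k u) \<in> b_dual a"
proof -
  have add: "T k ((x + y) # a) = T k (x # a) + T k (y # a)"
    and scale: "T k (scale c x # a) = c * T k (x # a)" if "k \<in> K" for k x y c
    using T[OF that] by (auto simp: b_dual_def)
  have "\<forall>k\<in>K. \<exists>M>0. \<forall>x. norm (T k (x # a)) \<le> M * nnorm (x # a)"
    using T by (auto simp: b_dual_def)
  then obtain M where M: "\<And>k. k \<in> K \<Longrightarrow> 0 < M k"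
      "\<And>k x. k \<in> K \<Longrightarrow> norm (T k (x # a)) \<le> M k * nnorm (x # a)"
    by metis
  \<comment> \<open>The summand 1 keeps the bound positive when all coefficients vanish.\<close>
  define B where "B = 1 + (\<Sum>k\<in>K. norm (\<alpha> k) * M k)"
  have "B > 0"
    unfolding B_def using M(1) by (intro add_pos_nonneg sum_nonneg) (auto simp: less_imp_le)
  moreover have "norm (\<Sum>k\<in>K. \<alpha> k * T k (x # a)) \<le> B * nnorm (x # a)" for x
  proof -
    have "norm (\<Sum>k\<in>K. \<alpha> k * T k (x # a)) \<le> (\<Sum>k\<in>K. norm (\<alpha> k) * (M k * nnorm (x # a)))"
      by (intro sum_norm_le) (auto simp: norm_mult intro!: mult_left_mono M)
    also have "\<dots> \<le> B * nnorm (x # a)"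
      using nnorm_nonneg[OF a] by (simp add: B_def distrib_right sum_distrib_right mult.assoc)
    finally show ?thesis .
  qed
  ultimately show ?thesis
    by (auto simp: b_dual_def Cons_in_b_domain add scale algebra_simps sum.distrib sum_distrib_left
        intro!: sum.cong)
qed

lemma linear_combination_upper_bound:
  fixes T :: "'j \<Rightarrow> 'i \<Rightarrow> 'x list \<Rightarrow> 'k"
  assumes K: "finite K" and p: "0 \<le> p" and B: "\<And>k. k \<in> K \<Longrightarrow> 0 < B k"
    and bound: "\<And>k. k \<in> K \<Longrightarrow>
      (\<Sum>\<^sub>\<infinity>i\<in>I. ennreal (norm (T k i (x # a)) powr p)) \<le> ennreal (B k * nnorm (x # a) powr p)"
  shows "(\<Sum>\<^sub>\<infinity>i\<in>I. ennreal (norm (\<Sum>k\<in>K. \<alpha> k * T k i (x # a)) powr p))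
    \<le> ennreal ((\<Sum>k\<in>K. (real (card K) * norm (\<alpha> k)) powr p * B k) * nnorm (x # a) powr p)"
proof (rule infsum_ennreal_le)
  fix F assume F: "finite F" "F \<subseteq> I"
  define C where "C k = (real (card K) * norm (\<alpha> k)) powr p" for k
  have "norm (\<Sum>k\<in>K. \<alpha> k * T k i (x # a)) powr p \<le> (\<Sum>k\<in>K. C k * norm (T k i (x # a)) powr p)" for i
  proof -
    have "norm (\<Sum>k\<in>K. \<alpha> k * T k i (x # a)) powr p
        \<le> (\<Sum>k\<in>K. norm (\<alpha> k) * norm (T k i (x # a))) powr p"
      using p by (intro powr_mono2 sum_norm_le) (auto simp: norm_mult)
    also have "\<dots> \<le> real (card K) powr p * (\<Sum>k\<in>K. (norm (\<alpha> k) * norm (T k i (x # a))) powr p)"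
      using K p by (intro sum_powr_le) auto
    also have "\<dots> = (\<Sum>k\<in>K. C k * norm (T k i (x # a)) powr p)"
      by (simp add: C_def sum_distrib_left powr_mult mult.assoc)
    finally show ?thesis .
  qed
  then have "(\<Sum>i\<in>F. ennreal (norm (\<Sum>k\<in>K. \<alpha> k * T k i (x # a)) powr p))
      \<le> (\<Sum>i\<in>F. ennreal (\<Sum>k\<in>K. C k * norm (T k i (x # a)) powr p))"
    by (intro sum_mono ennreal_leI)
  also have "\<dots> = (\<Sum>i\<in>F. \<Sum>k\<in>K. ennreal (C k) * ennreal (norm (T k i (x # a)) powr p))"
    by (simp add: C_def ennreal_mult flip: sum_ennreal)
  also have "\<dots> = (\<Sum>k\<in>K. ennreal (C k) * (\<Sum>i\<in>F. ennreal (norm (T k i (x # a)) powr p)))"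
    by (subst sum.swap) (simp only: sum_distrib_left)
  also have "\<dots> \<le> (\<Sum>k\<in>K. ennreal (C k) * ennreal (B k * nnorm (x # a) powr p))"
    by (intro sum_mono mult_left_mono order_trans[OF sum_le_infsum_ennreal[OF F] bound]) auto
  also have "\<dots> = (\<Sum>k\<in>K. ennreal (C k * B k * nnorm (x # a) powr p))"
    using B by (intro sum.cong) (auto simp: C_def less_imp_le mult.assoc simp flip: ennreal_mult)
  also have "\<dots> = ennreal ((\<Sum>k\<in>K. C k * B k) * nnorm (x # a) powr p)"
    using B by (subst sum_ennreal) (auto simp: C_def less_imp_le sum_distrib_right)
  finally show "(\<Sum>i\<in>F. ennreal (norm (\<Sum>k\<in>K. \<alpha> k * T k i (x # a)) powr p))
      \<le> ennreal ((\<Sum>k\<in>K. (real (card K) * norm (\<alpha> k)) powr p * B k) * nnorm (x # a) powr p)"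
    by (simp add: C_def)
qed

lemma p_frame_linear_combination:
  assumes a: "length a = n - 1" and p: "0 \<le> p" and K: "finite K" and m: "m \<in> K" and \<beta>: "0 < \<beta>"
    and T: "\<And>k. k \<in> K \<Longrightarrow> p_frame p a I (T k)"
    and comparison: "\<And>x. ennreal \<beta> * (\<Sum>\<^sub>\<infinity>i\<in>I. ennreal (norm (T m i (x # a)) powr p))
      \<le> (\<Sum>\<^sub>\<infinity>i\<in>I. ennreal (norm (\<Sum>k\<in>K. \<alpha> k * T k i (x # a)) powr p))"
  shows "p_frame p a I (\<lambda>i. \<lambda>u\<in>b_domain a. \<Sum>k\<in>K. \<alpha> k * T k i u)"
proof -
  have countable: "countable I"
    using T[OF m] by (simp add: p_frame_def)
  have dual: "(\<lambda>u\<in>b_domain a. \<Sum>k\<in>K. \<alpha> k * T k i u) \<in> b_dual a" if "i \<in> I" for i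
    using T that by (intro b_dual_linear_combination a) (auto simp: p_frame_def)

  obtain A where A: "0 < A" "\<And>x. ennreal (A * nnorm (x # a) powr p)
      \<le> (\<Sum>\<^sub>\<infinity>i\<in>I. ennreal (norm (T m i (x # a)) powr p))"
    using T[OF m] unfolding p_frame_def by blast
  have lower: "ennreal (\<beta> * A * nnorm (x # a) powr p)
      \<le> (\<Sum>\<^sub>\<infinity>i\<in>I. ennreal (norm (\<Sum>k\<in>K. \<alpha> k * T k i (x # a)) powr p))" for x
  proof -
    have "ennreal (\<beta> * A * nnorm (x # a) powr p) = ennreal \<beta> * ennreal (A * nnorm (x # a) powr p)"
      using \<beta> A(1) by (simp add: mult.assoc flip: ennreal_mult)
    also have "\<dots> \<le> ennreal \<beta> * (\<Sum>\<^sub>\<infinity>i\<in>I. ennreal (norm (T m i (x # a)) powr p))"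
      by (intro mult_left_mono A(2)) simp
    finally show ?thesis
      using comparison by (rule order_trans)
  qed

  have "\<forall>k\<in>K. \<exists>B>0. \<forall>x. (\<Sum>\<^sub>\<infinity>i\<in>I. ennreal (norm (T k i (x # a)) powr p))
      \<le> ennreal (B * nnorm (x # a) powr p)"
    using T unfolding p_frame_def by blast
  then obtain B where B: "\<And>k. k \<in> K \<Longrightarrow> 0 < B k"
      "\<And>k x. k \<in> K \<Longrightarrow> (\<Sum>\<^sub>\<infinity>i\<in>I. ennreal (norm (T k i (x # a)) powr p))
        \<le> ennreal (B k * nnorm (x # a) powr p)"
    by metis
  \<comment> \<open>The summand 1 keeps the bound positive when all coefficients vanish.\<close>
  define D where "D = 1 + (\<Sum>k\<in>K. (real (card K) * norm (\<alpha> k)) powr p * B k)"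
  have D: "0 < D"
    unfolding D_def using B(1) by (intro add_pos_nonneg sum_nonneg) (auto simp: less_imp_le)
  have upper: "(\<Sum>\<^sub>\<infinity>i\<in>I. ennreal (norm (\<Sum>k\<in>K. \<alpha> k * T k i (x # a)) powr p))
      \<le> ennreal (D * nnorm (x # a) powr p)" for x
  proof -
    have "(\<Sum>\<^sub>\<infinity>i\<in>I. ennreal (norm (\<Sum>k\<in>K. \<alpha> k * T k i (x # a)) powr p))
        \<le> ennreal ((\<Sum>k\<in>K. (real (card K) * norm (\<alpha> k)) powr p * B k) * nnorm (x # a) powr p)"
      using K p B by (rule linear_combination_upper_bound)
    also have "\<dots> \<le> ennreal (D * nnorm (x # a) powr p)"
      by (intro ennreal_leI mult_right_mono) (auto simp: D_def)
    finally show ?thesis .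
  qed

  have "0 < \<beta> * A"
    using \<beta> A(1) by simp
  with D lower upper countable dual show ?thesis
    by (auto simp: p_frame_def Cons_in_b_domain)
qed

end

theorem theorem5p4:
  fixes scale :: "'k::real_normed_field \<Rightarrow> 'x::ab_group_add \<Rightarrow> 'x"
    and nnorm :: "'x list \<Rightarrow> real"
    and n l :: nat and p :: real and a :: "'x list" and I :: "'i set"
    and T :: "nat \<Rightarrow> 'i \<Rightarrow> 'x list \<Rightarrow> 'k" and \<alpha> :: "nat \<Rightarrow> 'k"
  assumes "n_Banach_space scale n nnorm"
    and "length a = n - 1"
    and "1 < p"
    and "countable I"
    and "\<And>k. k \<in> {1..l} \<Longrightarrow> n_normed_space.p_frame scale nnorm p a I (T k)"
    and "\<exists>\<beta>>0. \<exists>m\<in>{1..l}. \<forall>x.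
           ennreal \<beta> * (\<Sum>\<^sub>\<infinity>i\<in>I. ennreal (norm (T m i (x # a)) powr p))
             \<le> (\<Sum>\<^sub>\<infinity>i\<in>I. ennreal (norm (\<Sum>k=1..l. \<alpha> k * T k i (x # a)) powr p))"
  shows "n_normed_space.p_frame scale nnorm p a I
           (\<lambda>i. \<lambda>u\<in>vector_space.b_domain scale a. \<Sum>k=1..l. \<alpha> k * T k i u)"
proof -
  interpret n_Banach_space scale n nnorm
    by (rule assms(1))
  obtain \<beta> m where "0 < \<beta>" "m \<in> {1..l}"
    "\<And>x. ennreal \<beta> * (\<Sum>\<^sub>\<infinity>i\<in>I. ennreal (norm (T m i (x # a)) powr p))
      \<le> (\<Sum>\<^sub>\<infinity>i\<in>I. ennreal (norm (\<Sum>k=1..l. \<alpha> k * T k i (x # a)) powr p))"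
    using assms(6) by blast
  then show ?thesis
    using assms(2,3,5) by (intro p_frame_linear_combination[where m = m and \<beta> = \<beta>]) auto
qed

end
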